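(* For all integers $n\ge0$, \[ E_n(-q,q) = \frac{1}{(1-q)^{2n}} \sum_{k=0}^n \left( \binom{2n}{n-k} - \binom{2n}{n-k-1} \right) (-1)^k\,\frac{q^{k^2}+q^{(k+1)^2}}{1+q}. \]
   Context: Here $[n]_q=(1-q^n)/(1-q)$ and $[n]_{t,q}=(1-tq^n)/(1-q)$. The $(t,q)$-Euler numbers $E_n(t,q)$, $n\ge 0$, are defined by the continued fraction expansion (as a formal power series in $x$) \[ \sum_{n\geq0} E_{n}(t,q) x^n = \cfrac{1}{1- \cfrac{[1]_q[1]_{t,q}\, x}{1- \cfrac{[2]_q[2]_{t,q}\, x}{1-\cdots}}}, \] where the $m$-th partial coefficient is $[m]_q[m]_{t,q}$. $E_n(-q,q)$ is the value at $t=-q$. Binomial coefficients $\binom{a}{b}$ with $b<0$ are $0$. *)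

theory Defs
  imports "HOL-Computational_Algebra.Computational_Algebra"
begin

definition qint :: "'a::field \<Rightarrow> nat \<Rightarrow> 'a" where
  "qint q n = (1 - q ^ n) / (1 - q)"

definition tqint :: "'a::field \<Rightarrow> 'a \<Rightarrow> nat \<Rightarrow> 'a" where
  "tqint t q n = (1 - t * q ^ n) / (1 - q)"

text \<open>
  \<open>sfrac_conv c m N\<close> is the finite continued fraction
  \<open>1 / (1 - c m x / (1 - c (m+1) x / (\<dots> / (1 - c (m+N-1) x))))\<close> with \<open>N\<close> partial coefficients.
\<close>
primrec sfrac_conv :: "(nat \<Rightarrow> 'a::field) \<Rightarrow> nat \<Rightarrow> nat \<Rightarrow> 'a fps" where
  "sfrac_conv c m 0 = 1"
| "sfrac_conv c m (Suc N) = 1 / (1 - fps_const (c m) * fps_X * sfrac_conv c (Suc m) N)"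

text \<open>
  The infinite continued fraction with partial coefficients \<open>c 1, c 2, \<dots>\<close>: the limit of the
  convergents in the \<open>x\<close>-adic topology. It always exists, see \<open>sfrac_conv_tendsto\<close> below.
\<close>
definition sfrac :: "(nat \<Rightarrow> 'a::field) \<Rightarrow> 'a fps" where
  "sfrac c = lim (\<lambda>N. sfrac_conv c 1 N)"

text \<open>
  The parameters are elements of an arbitrary field, so they may be taken to be indeterminates
  of a field of rational functions. Every coefficient of the continued fraction is a polynomial
  in its partial coefficients, hence a polynomial in \<open>t\<close>, and substituting for \<open>t\<close> in \<open>E\<^sub>n(t,q)\<close> is the
  same as substituting in the partial coefficients.
\<close>
definition euler_tq :: "nat \<Rightarrow> 'a::field \<Rightarrow> 'a \<Rightarrow> 'a" where
  "euler_tq n t q = fps_nth (sfrac (\<lambda>m. qint q m * tqint t q m)) n"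

text \<open>Binomial coefficient with an integer lower index, zero if that index is negative.\<close>
definition zbinom :: "nat \<Rightarrow> int \<Rightarrow> nat" where
  "zbinom a b = (if b < 0 then 0 else a choose nat b)"

lemma sfrac_conv_mult:
  "sfrac_conv c m (Suc N) * (1 - fps_const (c m) * fps_X * sfrac_conv c (Suc m) N) = 1"
proof -
  have "fps_nth (1 - fps_const (c m) * fps_X * sfrac_conv c (Suc m) N) 0 \<noteq> 0"
    by simp
  then show ?thesis
    by (simp add: fps_divide_unit inverse_mult_eq_1)
qed

lemma sfrac_conv_diff_dvd: "fps_X ^ Suc N dvd sfrac_conv c m (Suc N) - sfrac_conv c m N"
proof (induction N arbitrary: m)
  case 0
  define f where "f = sfrac_conv c m (Suc 0)"
  have "f * (1 - fps_const (c m) * fps_X) = 1"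
    using sfrac_conv_mult[of c m 0] by (simp add: f_def del: sfrac_conv.simps(2))
  then have "f - 1 = fps_X * (f * fps_const (c m))"
    by (simp add: algebra_simps)
  then show ?case
    by (simp add: f_def[symmetric] del: sfrac_conv.simps(2))
next
  case (Suc N)
  define f where "f = sfrac_conv c m (Suc (Suc N))"
  define g where "g = sfrac_conv c m (Suc N)"
  define u where "u = sfrac_conv c (Suc m) (Suc N)"
  define v where "v = sfrac_conv c (Suc m) N"
  define a where "a = fps_const (c m) * fps_X"
  have f: "f * (1 - a * u) = 1" and g: "g * (1 - a * v) = 1"
    unfolding f_def g_def u_def v_def a_def by (rule sfrac_conv_mult)+
  have "f - g = f * (g * (1 - a * v)) - g * (f * (1 - a * u))"
    by (simp add: f g)
  also have "\<dots> = (f * g * fps_const (c m)) * (fps_X * (u - v))"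
    by (simp add: a_def algebra_simps)
  finally have "f - g = (f * g * fps_const (c m)) * (fps_X * (u - v))" .
  moreover have "fps_X ^ Suc (Suc N) dvd fps_X * (u - v)"
    using Suc.IH[of "Suc m"] unfolding u_def v_def by (simp add: mult_dvd_mono del: sfrac_conv.simps)
  ultimately show ?case
    unfolding f_def g_def by (metis dvd_mult)
qed

lemma sfrac_conv_nth_eq:
  assumes "n \<le> N"
  shows "fps_nth (sfrac_conv c m N) n = fps_nth (sfrac_conv c m n) n"
  using assms
proof (induction N rule: dec_induct)
  case (step N)
  obtain h where "sfrac_conv c m (Suc N) - sfrac_conv c m N = fps_X ^ Suc N * h"
    using sfrac_conv_diff_dvd[of N c m] unfolding dvd_def by blast
  then have "fps_nth (sfrac_conv c m (Suc N) - sfrac_conv c m N) n = 0"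
    using step.hyps by (simp only: fps_X_power_mult_nth) simp
  with step.IH show ?case
    by (simp del: sfrac_conv.simps)
qed simp

lemma sfrac_conv_tendsto: "(\<lambda>N. sfrac_conv c 1 N) \<longlonglongrightarrow> sfrac c"
proof -
  have "(\<lambda>N. sfrac_conv c 1 N) \<longlonglongrightarrow> Abs_fps (\<lambda>n. fps_nth (sfrac_conv c 1 n) n)"
    by (rule tendsto_fpsI)
       (auto simp: eventually_sequentially intro!: sfrac_conv_nth_eq)
  then show ?thesis
    unfolding sfrac_def by (metis limI)
qed

lemma sfrac_nth: "fps_nth (sfrac c) n = fps_nth (sfrac_conv c 1 n) n"
proof -
  have "\<forall>\<^sub>F N in sequentially. fps_nth (sfrac_conv c 1 N) n = fps_nth (sfrac c) n"
    using sfrac_conv_tendsto[of c] unfolding tendsto_fps_iff by blast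
  then obtain N where "\<forall>k\<ge>N. fps_nth (sfrac_conv c 1 k) n = fps_nth (sfrac c) n"
    unfolding eventually_sequentially by blast
  then have "fps_nth (sfrac_conv c 1 (max N n)) n = fps_nth (sfrac c) n"
    by simp
  then show ?thesis
    by (metis sfrac_conv_nth_eq max.cobounded2)
qed

end

theory Submission
  imports Defs
begin

text \<open>
  Let \<open>P\<^sub>n\<close> be the monic polynomials with \<open>x P\<^sub>n = P\<^sub>n\<^sub>+\<^sub>1 + \<lambda>\<^sub>n P\<^sub>n\<^sub>-\<^sub>1\<close>,
  \<open>\<lambda>\<^sub>n = (1 - q\<^sup>n) (1 + q\<^sup>n\<^sup>+\<^sup>1)\<close>, and \<open>U\<^sub>j\<close> the monic Chebyshev polynomials, with \<open>\<lambda>\<^sub>n\<close> replaced by \<open>1\<close>.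
  The \<open>2n\<close>-th moment of the functional \<open>L\<close> that kills every \<open>P\<^sub>n\<close> with \<open>n > 0\<close> is the coefficient of
  \<open>x\<^sup>n\<close> in the continued fraction. The \<open>P\<^sub>n\<close> are Al-Salam-Chihara polynomials with parameters
  \<open>(q, -q)\<close>; their weight is a theta function, and the mixed moments \<open>L (P\<^sub>n U\<^sub>j)\<close> are
  explicit products. Both three-term recurrences express multiplication by \<open>x\<close>, so \<open>L (x\<^sup>2\<^sup>n)\<close> can be
  computed from the values \<open>L (U\<^sub>j)\<close> and the expansion of \<open>x\<^sup>2\<^sup>n\<close> in the \<open>U\<^sub>j\<close>, whose coefficients are
  ballot numbers.
\<close>

text \<open>If \<open>f n\<close> is \<open>L (P\<^sub>n h)\<close> for a fixed polynomial h and the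
  \<open>P\<^sub>n\<close> have recurrence coefficients \<open>w n\<close>, then
  \<open>step w f n\<close> is \<open>L (x P\<^sub>n h)\<close>.\<close>

definition step :: "(nat \<Rightarrow> 'a::comm_ring_1) \<Rightarrow> (nat \<Rightarrow> 'a) \<Rightarrow> nat \<Rightarrow> 'a" where
  "step w f n = f (Suc n) + (case n of 0 \<Rightarrow> 0 | Suc m \<Rightarrow> w n * f m)"

lemma step_0: "step w f 0 = f (Suc 0)"
  and step_Suc: "step w f (Suc n) = f (Suc (Suc n)) + w (Suc n) * f n"
  by (simp_all add: step_def)

text \<open>Conjugation by the diagonal \<open>r ^ n\<close>. It serves to extract the denominators
  \<open>1 - q\<close> of the partial coefficients.\<close>

lemma step_funpow_scale:
  "(step (\<lambda>m. r\<^sup>2 * w m) ^^ s) (\<lambda>m. r ^ m * f m) n = r ^ (s + n) * (step w ^^ s) f n"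
proof (induction s arbitrary: n)
  case (Suc s)
  then show ?case
    by (cases n) (simp_all add: step_0 step_Suc algebra_simps power2_eq_square)
qed simp

text \<open>The recurrences act on different indices of \<open>D\<close>, so by linearity they
  commute, and factors x can be moved one at a time from the index \<open>n\<close> to the index
  \<open>j\<close>.\<close>

lemma step_funpow_commute:
  assumes "\<And>n j. step v (\<lambda>m. D m j) n = step w (D n) j"
  shows "(step v ^^ s) (\<lambda>m. D m j) n = (step w ^^ s) (D n) j"
proof (induction s arbitrary: n j)
  case (Suc s)
  have "(step v ^^ Suc s) (\<lambda>m. D m j) n = step v (\<lambda>m. (step w ^^ s) (D m) j) n"
    unfolding funpow.simps comp_def Suc.IH ..
  also have "\<dots> = (step w ^^ s) (\<lambda>i. step v (\<lambda>m. D m i) n) j"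
  proof -
    have add: "(step w ^^ s) (\<lambda>i. f i + a * g i) j = (step w ^^ s) f j + a * (step w ^^ s) g j"
      for f g a
    proof (induction s arbitrary: j)
      case (Suc s)
      then show ?case
        by (cases j) (simp_all add: step_0 step_Suc algebra_simps)
    qed simp
    show ?thesis
      by (cases n) (simp_all add: step_0 step_Suc add)
  qed
  also have "\<dots> = (step w ^^ Suc s) (D n) j"
    by (simp add: assms funpow_swap1)
  finally show ?case .
qed simp

subsection \<open>Continued fractions and weighted paths\<close>

definition sfrac_tail :: "(nat \<Rightarrow> 'a::field) \<Rightarrow> nat \<Rightarrow> 'a fps" where
  "sfrac_tail c m = Abs_fps (\<lambda>n. fps_nth (sfrac_conv c m n) n)"

lemma sfrac_tail_1: "sfrac_tail c 1 = sfrac c"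
  by (simp add: sfrac_tail_def fps_eq_iff sfrac_nth)

text \<open>Clearing the denominator of a convergent gives the same equation for convergents;
  coefficient \<open>n\<close> has already stabilised at order \<open>n\<close>, so it passes to the
  limit.\<close>

lemma sfrac_tail_rec:
  "sfrac_tail c m = 1 + fps_X * fps_const (c m) * sfrac_tail c m * sfrac_tail c (Suc m)"
proof (rule fps_ext)
  fix n
  have nth: "fps_nth (sfrac_conv c k N) i = fps_nth (sfrac_tail c k) i" if "i \<le> N" for k i N
    using sfrac_conv_nth_eq[OF that] by (simp add: sfrac_tail_def)
  have "f = f * (1 - a * x * g) + x * (a * (f * g))" for a x f g :: "'a fps"
    by (simp add: algebra_simps)
  from this[of "sfrac_conv c m (Suc n)" "fps_const (c m)" fps_X "sfrac_conv c (Suc m) n"]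
  have conv: "sfrac_conv c m (Suc n) =
      1 + fps_X * (fps_const (c m) * (sfrac_conv c m (Suc n) * sfrac_conv c (Suc m) n))"
    unfolding sfrac_conv_mult .
  have "fps_nth (sfrac_tail c m) n = fps_nth (sfrac_conv c m (Suc n)) n"
    by (rule nth[symmetric]) simp
  also have "\<dots> = fps_nth
      (1 + fps_X * (fps_const (c m) * (sfrac_conv c m (Suc n) * sfrac_conv c (Suc m) n))) n"
    by (rule arg_cong[OF conv])
  also have "\<dots> = fps_nth
      (1 + fps_X * (fps_const (c m) * (sfrac_tail c m * sfrac_tail c (Suc m)))) n"
    by (simp add: fps_mult_nth[of "sfrac_conv c m (Suc n)"] fps_mult_nth[of "sfrac_tail c m"] nth
        del: sfrac_conv.simps)
  finally show "fps_nth (sfrac_tail c m) n = fps_nth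
      (1 + fps_X * fps_const (c m) * sfrac_tail c m * sfrac_tail c (Suc m)) n"
    by (simp only: mult.assoc)
qed

text \<open>The generating function of the weighted paths from height \<open>n\<close> to height \<open>0\<close>, by half of the
  length in excess of \<open>n\<close>.\<close>
primrec path_fps :: "(nat \<Rightarrow> 'a::field) \<Rightarrow> nat \<Rightarrow> 'a fps" where
  "path_fps c 0 = sfrac_tail c 1"
| "path_fps c (Suc n) = fps_const (c (Suc n)) * path_fps c n * sfrac_tail c (Suc (Suc n))"

lemma path_fps_0_rec: "path_fps c 0 = 1 + fps_X * path_fps c (Suc 0)"
  by (rule trans[OF path_fps.simps(1) trans[OF sfrac_tail_rec]]) (simp add: mult_ac)

lemma path_fps_Suc_rec:
  "path_fps c (Suc n) = fps_const (c (Suc n)) * path_fps c n + fps_X * path_fps c (Suc (Suc n))"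
proof -
  define F where "F = sfrac_tail c (Suc (Suc n))"
  define G where "G = fps_const (c (Suc (Suc n))) * sfrac_tail c (Suc (Suc (Suc n)))"
  have F: "F = 1 + fps_X * F * G"
    unfolding F_def G_def by (subst (1) sfrac_tail_rec) (simp add: mult_ac)
  have "path_fps c (Suc n) = fps_const (c (Suc n)) * path_fps c n * (1 + fps_X * F * G)"
    by (subst F[symmetric]) (simp add: F_def)
  also have "\<dots> = fps_const (c (Suc n)) * path_fps c n
      + fps_X * (G * (fps_const (c (Suc n)) * path_fps c n * F))"
    by (simp add: distrib_left mult_ac del: path_fps.simps)
  finally show ?thesis
    by (simp add: F_def G_def mult_ac)
qed

lemma path_fps_nth:
  "fps_nth (path_fps c 0) 0 = 1"
  "fps_nth (path_fps c 0) (Suc k) = fps_nth (path_fps c (Suc 0)) k"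
  "fps_nth (path_fps c (Suc n)) 0 = c (Suc n) * fps_nth (path_fps c n) 0"
  "fps_nth (path_fps c (Suc n)) (Suc k) =
      c (Suc n) * fps_nth (path_fps c n) (Suc k) + fps_nth (path_fps c (Suc (Suc n))) k"
proof -
  show "fps_nth (path_fps c 0) 0 = 1"
    and "fps_nth (path_fps c 0) (Suc k) = fps_nth (path_fps c (Suc 0)) k"
    by (subst path_fps_0_rec, simp del: path_fps.simps)+
  show "fps_nth (path_fps c (Suc n)) 0 = c (Suc n) * fps_nth (path_fps c n) 0"
    and "fps_nth (path_fps c (Suc n)) (Suc k) =
      c (Suc n) * fps_nth (path_fps c n) (Suc k) + fps_nth (path_fps c (Suc (Suc n))) k"
    by (subst path_fps_Suc_rec, simp add: mult.assoc del: path_fps.simps)+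
qed

text \<open>Both sides count paths of length \<open>s\<close> from height \<open>n\<close> to
  \<open>0\<close>, a descent from height \<open>m\<close> weighing \<open>c m\<close>; the first
  step of a path gives the induction.\<close>

lemma step_funpow_eq_path_fps:
  "(step c ^^ s) (\<lambda>m. if m = 0 then 1 else 0) n =
    (if n \<le> s \<and> even (s - n) then fps_nth (path_fps c n) ((s - n) div 2) else 0)"
proof (induction s arbitrary: n)
  case 0
  show ?case
    by (auto simp: path_fps_nth simp del: path_fps.simps)
next
  case (Suc s)
  show ?case
  proof (cases n)
    case 0
    show ?thesis
    proof (cases "even (Suc s)")
      case True
      then obtain k where k: "s = 2 * k + 1"
        by (auto elim: oddE)
      show ?thesis
        unfolding funpow.simps comp_def 0 step_0 Suc.IH unfolding k
        by (simp add: path_fps_nth del: path_fps.simps)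
    qed (use 0 Suc in \<open>auto simp: step_0\<close>)
  next
    case n: (Suc m)
    show ?thesis
    proof (cases "m \<le> s \<and> even (s - m)")
      case True
      then obtain k where k: "s = m + 2 * k"
        by (metis evenE le_add_diff_inverse)
      \<comment> \<open>For \<open>k = 0\<close> only the straight descent remains, and the upward
        neighbour contributes zero.\<close>
      show ?thesis
        unfolding funpow.simps comp_def n step_Suc Suc.IH unfolding k
        by (cases k) (simp_all add: path_fps_nth del: path_fps.simps)
    next
      case False
      then have "(m \<le> s \<and> even (s - m)) = False"
          "(Suc (Suc m) \<le> s \<and> even (s - Suc (Suc m))) = False"
          "(Suc m \<le> Suc s \<and> even (Suc s - Suc m)) = False"
        by auto
      then show ?thesis
        unfolding funpow.simps comp_def n step_Suc Suc.IH by (simp only: if_False) simp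
    qed
  qed
qed

lemma sfrac_nth_eq_step_funpow:
  "fps_nth (sfrac c) n = (step c ^^ (2 * n)) (\<lambda>m. if m = 0 then 1 else 0) 0"
  by (simp add: step_funpow_eq_path_fps sfrac_tail_1[unfolded One_nat_def])

subsection \<open>Ballot numbers\<close>

text \<open>The reflection principle: a sequence extended antisymmetrically about \<open>-1\<close>.\<close>
definition reflect :: "(nat \<Rightarrow> 'a::comm_ring_1) \<Rightarrow> int \<Rightarrow> 'a" where
  "reflect g j = (if j \<ge> 0 then g (nat j) else if j = -1 then 0 else - g (nat (- 2 - j)))"

text \<open>On all integers the walk is free, with \<open>i\<close> counting its down steps.
  Antisymmetry persists and forces the value 0 at \<open>-1\<close>, which stands in for the missing
  lower neighbour of \<open>0\<close>.\<close>

lemma step_funpow_reflect: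
  "(step (\<lambda>_. 1) ^^ s) g j = (\<Sum>i\<le>s. of_nat (s choose i) * reflect g (int j + int s - 2 * int i))"
proof -
  define G where "G s j = (\<Sum>i\<le>s. of_nat (s choose i) * reflect g (j + int s - 2 * int i))"
    for s and j :: int
  have G_Suc: "G (Suc s) j = G s (j + 1) + G s (j - 1)" for s j
  proof -
    define r where "r i = reflect g (j + 1 + int s - 2 * int i)" for i
    have "G (Suc s) j = r 0 + (\<Sum>i\<le>s. of_nat (Suc s choose Suc i) * r (Suc i))"
      unfolding G_def r_def by (subst sum.atMost_Suc_shift) (simp add: algebra_simps)
    also have "\<dots> = (r 0 + (\<Sum>i\<le>s. of_nat (s choose Suc i) * r (Suc i)))
        + (\<Sum>i\<le>s. of_nat (s choose i) * r (Suc i))"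
      by (simp add: algebra_simps sum.distrib)
    also have "r 0 + (\<Sum>i\<le>s. of_nat (s choose Suc i) * r (Suc i)) =
        (\<Sum>i\<le>Suc s. of_nat (s choose i) * r i)"
      by (subst sum.atMost_Suc_shift) simp
    also have "\<dots> = G s (j + 1)"
      by (simp add: G_def r_def binomial_eq_0)
    also have "(\<Sum>i\<le>s. of_nat (s choose i) * r (Suc i)) = G s (j - 1)"
      by (simp add: G_def r_def algebra_simps)
    finally show ?thesis .
  qed
  have antisym: "G s (- 2 - j) = - G s j" for s j
  proof (induction s arbitrary: j)
    case 0
    show ?case by (auto simp: G_def reflect_def)
  next
    case (Suc s)
    show ?case
      using Suc[of "j + 1"] Suc[of "j - 1"] by (simp add: G_Suc algebra_simps)
  qed
  have G_m1: "G s (- 1) = 0" for s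
  proof (induction s)
    case 0
    show ?case by (simp add: G_def reflect_def)
  next
    case (Suc s)
    show ?case
      using antisym[of s 0] by (simp add: G_Suc)
  qed
  have "(step (\<lambda>_. 1) ^^ s) g j = G s (int j)"
  proof (induction s arbitrary: j)
    case 0
    show ?case by (simp add: G_def reflect_def)
  next
    case (Suc s)
    then show ?case
      using G_m1[of s] by (cases j) (simp_all add: step_0 step_Suc G_Suc add_ac)
  qed
  then show ?thesis by (simp add: G_def)
qed

lemma step_funpow_ballot:
  "(step (\<lambda>_. 1) ^^ (2 * n)) g 0 =
    (\<Sum>k = 0..n. (of_nat (zbinom (2 * n) (int n - int k))
      - of_nat (zbinom (2 * n) (int n - int k - 1))) * g (2 * k))"
proof -
  define h where "h i = of_nat (2 * n choose i) * reflect g (2 * int n - 2 * int i)" for i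
  have "(step (\<lambda>_. 1) ^^ (2 * n)) g 0 = (\<Sum>i\<in>{..n} \<union> {Suc n..2 * n}. h i)"
    unfolding step_funpow_reflect h_def by (intro sum.cong) auto
  also have "\<dots> = (\<Sum>i\<le>n. h i) + (\<Sum>i = Suc n..2 * n. h i)"
    by (rule sum.union_disjoint) auto
  also have "(\<Sum>i\<le>n. h i) = (\<Sum>k = 0..n. of_nat (zbinom (2 * n) (int n - int k)) * g (2 * k))"
    by (rule sum.reindex_bij_witness[of _ "\<lambda>k. n - k" "\<lambda>k. n - k"])
       (auto simp: h_def zbinom_def reflect_def nat_diff_distrib nat_mult_distrib diff_mult_distrib2)
  \<comment> \<open>The term \<open>i = n + 1 + k\<close> sits at position
    \<open>-2 - 2 * k\<close>, the mirror image of \<open>2 * k\<close>, hence the minus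
    sign.\<close>
  also have "(\<Sum>i = Suc n..2 * n. h i) =
      - (\<Sum>k\<in>{0..<n}. of_nat (zbinom (2 * n) (int n - int k - 1)) * g (2 * k))"
    unfolding sum_negf[symmetric]
  proof (rule sum.reindex_bij_witness[of _ "\<lambda>k. Suc (n + k)" "\<lambda>i. i - Suc n"])
    fix i assume "i \<in> {Suc n..2 * n}"
    then obtain k where k: "i = Suc (n + k)" "k < n"
      by (auto dest: le_Suc_ex)
    have "2 * n choose i = 2 * n choose (n - k - 1)"
      using k by (subst binomial_symmetric) auto
    moreover have "nat (int n - int k - 1) = n - k - 1" "nat (2 * int k) = 2 * k"
      using k by auto
    ultimately show "- (of_nat (zbinom (2 * n) (int n - int (i - Suc n) - 1)) * g (2 * (i - Suc n))) = h i"
      using k by (simp add: h_def zbinom_def reflect_def)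
  qed auto
  \<comment> \<open>The added term \<open>k = n\<close> has lower index \<open>-1\<close>, so its
    \<open>zbinom\<close> is 0.\<close>
  also have "(\<Sum>k\<in>{0..<n}. of_nat (zbinom (2 * n) (int n - int k - 1)) * g (2 * k)) =
      (\<Sum>k = 0..n. of_nat (zbinom (2 * n) (int n - int k - 1)) * g (2 * k))"
    by (simp add: atLeastLessThanSuc_atLeastAtMost[symmetric] zbinom_def)
  finally show ?thesis
    by (simp add: sum_subtractf algebra_simps)
qed

subsection \<open>Mixed moments\<close>

text \<open>The mixed moment \<open>L (P\<^sub>n U\<^sub>j)\<close>, normalised by \<open>L 1 = 1 + q\<close>.\<close>
definition mixed_moment :: "'a::comm_ring_1 \<Rightarrow> nat \<Rightarrow> nat \<Rightarrow> 'a" where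
  "mixed_moment q n j = (if n \<le> j \<and> even (j - n)
    then (let i = (j - n) div 2 in
      (- 1) ^ i * q ^ (i\<^sup>2) * (1 + q ^ (n + 2 * i + 1)) * (\<Prod>l<n. 1 - q ^ (2 * i + 2 + 2 * l)))
    else 0)"

lemma mixed_moment_add:
  "mixed_moment q n (n + 2 * i) =
    (- 1) ^ i * q ^ (i\<^sup>2) * (1 + q ^ (n + 2 * i + 1)) * (\<Prod>l<n. 1 - q ^ (2 * i + 2 + 2 * l))"
  by (simp add: mixed_moment_def Let_def)

lemma mixed_moment_eq_0: "\<not> (n \<le> j \<and> even (j - n)) \<Longrightarrow> mixed_moment q n j = 0"
  by (auto simp: mixed_moment_def)

lemma mixed_moment_0:
  "mixed_moment q 0 (2 * k) = (- 1) ^ k * (q ^ (k\<^sup>2) + q ^ ((k + 1)\<^sup>2))"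
proof -
  have "(k + 1)\<^sup>2 = k\<^sup>2 + (2 * k + 1)"
    by (simp add: power2_eq_square)
  then show ?thesis
    using mixed_moment_add[of q 0 k] by (simp add: power_add distrib_left mult.assoc)
qed

text \<open>Since \<open>U\<^sub>0 = 1\<close>, this is the defining property of L.\<close>

lemma mixed_moment_at_0: "mixed_moment q n 0 = (if n = 0 then 1 + q else 0)"
  by (simp add: mixed_moment_def)

lemma mixed_moment_diag:
  "mixed_moment q (Suc n) (Suc n) = (1 - q ^ Suc n) * (1 + q ^ Suc (Suc n)) * mixed_moment q n n"
proof -
  have "q ^ (2 + 2 * n) = q ^ Suc n * q ^ Suc n"
    by (simp add: mult_2 power_add mult.assoc mult.left_commute)
  then have "1 - q ^ (2 + 2 * n) = (1 - q ^ Suc n) * (1 + q ^ Suc n)"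
    by (simp add: algebra_simps)
  then show ?thesis
    using mixed_moment_add[of q "Suc n" 0] mixed_moment_add[of q n 0]
    by (simp add: mult_ac)
qed

lemma mixed_moment_rec_0:
  "mixed_moment q (Suc 0) (1 + 2 * i) = mixed_moment q 0 (2 * Suc i) + mixed_moment q 0 (2 * i)"
proof -
  define Y p where "Y = q ^ (2 * i)" and "p = (- 1) ^ i * q ^ (i\<^sup>2)"
  have sq: "(- 1) ^ Suc i * q ^ ((Suc i)\<^sup>2) = - (p * q * Y)"
    by (simp add: p_def Y_def power2_eq_square power_add mult_ac power_mult)
  have "mixed_moment q (Suc 0) (1 + 2 * i) = p * (1 + q\<^sup>2 * Y) * (1 - q\<^sup>2 * Y)"
    using mixed_moment_add[of q "Suc 0" i] unfolding p_def[symmetric]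
    by (simp add: Y_def power_add mult_ac eval_nat_numeral)
  moreover have "mixed_moment q 0 (2 * Suc i) = - (p * q * Y) * (1 + q ^ 3 * Y)"
    using mixed_moment_add[of q 0 "Suc i"] unfolding sq
    by (simp add: Y_def power_add mult_ac eval_nat_numeral)
  moreover have "mixed_moment q 0 (2 * i) = p * (1 + q * Y)"
    using mixed_moment_add[of q 0 i] unfolding p_def[symmetric]
    by (simp add: Y_def mult_ac)
  ultimately show ?thesis
    by (simp only:) (simp add: algebra_simps eval_nat_numeral)
qed

text \<open>The value of \<open>L (x P\<^sub>n\<^sub>+\<^sub>1 U\<^sub>j)\<close> by both
  recurrences, with \<open>j = n + 2 + 2 * i\<close>, solved for the
  \<open>P\<^sub>n\<^sub>+\<^sub>2\<close> term.\<close>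

lemma mixed_moment_rec:
  "mixed_moment q (Suc (Suc n)) (n + 2 + 2 * i) =
    mixed_moment q (Suc n) (n + 1 + 2 * Suc i) + mixed_moment q (Suc n) (n + 1 + 2 * i)
    - (1 - q ^ Suc n) * (1 + q ^ Suc (Suc n)) * mixed_moment q n (n + 2 * Suc i)"
proof -
  \<comment> \<open>All four moments share the factor \<open>p * R\<close>: \<open>low\<close>
    splits off the first factor of a product and \<open>high\<close> the last. What remains is a
    polynomial identity in \<open>q\<close>, \<open>Y\<close>, \<open>Z\<close>.\<close>
  define Y Z p R where "Y = q ^ (2 * i)" and "Z = q ^ n" and "p = (- 1) ^ i * q ^ (i\<^sup>2)"
    and "R = (\<Prod>l<n. 1 - q ^ (2 * Suc i + 2 + 2 * l))"
  have sq: "(- 1) ^ Suc i * q ^ ((Suc i)\<^sup>2) = - (p * q * Y)"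
    by (simp add: p_def Y_def power2_eq_square power_add mult_ac power_mult)
  have ZZ: "q ^ (2 * n) = Z * Z"
    by (simp add: Z_def mult_2 power_add)
  have low: "(\<Prod>l<Suc m. 1 - q ^ (2 * i + 2 + 2 * l)) =
      (1 - q\<^sup>2 * Y) * (\<Prod>l<m. 1 - q ^ (2 * Suc i + 2 + 2 * l))" for m
    by (subst prod.lessThan_Suc_shift) (simp add: Y_def power_add power2_eq_square mult_ac)
  have high: "(\<Prod>l<Suc n. 1 - q ^ (2 * Suc i + 2 + 2 * l)) = R * (1 - q ^ 4 * Y * (Z * Z))"
    by (simp add: R_def Y_def ZZ[symmetric] power_add mult_ac eval_nat_numeral)
  have "mixed_moment q (Suc (Suc n)) (n + 2 + 2 * i) =
      p * (1 + q ^ 3 * Y * Z) * ((1 - q\<^sup>2 * Y) * (R * (1 - q ^ 4 * Y * (Z * Z))))"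
    using mixed_moment_add[of q "Suc (Suc n)" i]
    unfolding low high p_def[symmetric]
    by (simp add: Y_def Z_def power_add mult_ac eval_nat_numeral)
  moreover have "mixed_moment q (Suc n) (n + 1 + 2 * Suc i) =
      - (p * q * Y) * (1 + q ^ 4 * Y * Z) * (R * (1 - q ^ 4 * Y * (Z * Z)))"
    using mixed_moment_add[of q "Suc n" "Suc i"]
    unfolding high sq by (simp add: Y_def Z_def power_add mult_ac eval_nat_numeral)
  moreover have "mixed_moment q (Suc n) (n + 1 + 2 * i) =
      p * (1 + q\<^sup>2 * Y * Z) * ((1 - q\<^sup>2 * Y) * R)"
    using mixed_moment_add[of q "Suc n" i]
    unfolding low p_def[symmetric] R_def[symmetric]
    by (simp add: Y_def Z_def power_add mult_ac eval_nat_numeral)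
  moreover have "mixed_moment q n (n + 2 * Suc i) = - (p * q * Y) * (1 + q ^ 3 * Y * Z) * R"
    using mixed_moment_add[of q n "Suc i"]
    unfolding sq R_def[symmetric] by (simp add: Y_def Z_def power_add mult_ac eval_nat_numeral)
  moreover have "q ^ Suc n = q * Z" "q ^ Suc (Suc n) = q\<^sup>2 * Z"
    by (simp_all add: Z_def power2_eq_square mult_ac)
  ultimately show ?thesis
    by (simp only:) (simp add: algebra_simps eval_nat_numeral)
qed

lemma step_mixed_moment:
  "step (\<lambda>m. (1 - q ^ m) * (1 + q ^ Suc m)) (\<lambda>m. mixed_moment q m j) n =
    step (\<lambda>_. 1) (mixed_moment q n) j"
proof -
  \<comment> \<open>Moments vanish below the diagonal and for odd \<open>j - n\<close>. So either
    all terms vanish, or \<open>n = j + 1\<close> and only diagonal moments survive, or the general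
    recurrence applies.\<close>
  consider (ge) i where "j = n + 1 + 2 * i" | (pred) "n = Suc j" | (odd) "\<not> (n \<le> Suc j \<and> even (Suc j - n))"
  proof (cases "n \<le> Suc j \<and> even (Suc j - n)")
    case True
    then obtain k where "Suc j = n + 2 * k"
      by (metis evenE le_add_diff_inverse)
    then show thesis
      using that(1)[of "k - 1"] that(2) by (cases k) auto
  qed (use that in blast)
  then show ?thesis
  proof cases
    case ge
    show ?thesis
    proof (cases n)
      case 0
      then show ?thesis
        using ge mixed_moment_rec_0[of q i] by (simp add: step_0 step_Suc)
    next
      case (Suc m)
      then show ?thesis
        using ge mixed_moment_rec[of q m i] by (simp add: step_Suc)
    qed
  next
    case pred
    then show ?thesis
      using mixed_moment_diag[of q j]
      by (cases j) (simp_all add: step_0 step_Suc mixed_moment_eq_0)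
  next
    case odd
    then show ?thesis
      by (cases n; cases j) (auto simp: step_0 step_Suc mixed_moment_def)
  qed
qed

theorem proposition5p9:
  fixes q :: "'a::field" and n :: nat
  assumes "q \<noteq> 1" and "q \<noteq> - 1"
  shows "euler_tq n (- q) q =
    1 / (1 - q) ^ (2 * n) *
    (\<Sum>k = 0..n. (of_nat (zbinom (2 * n) (int n - int k))
                   - of_nat (zbinom (2 * n) (int n - int k - 1)))
                 * (- 1) ^ k * ((q ^ (k\<^sup>2) + q ^ ((k + 1)\<^sup>2)) / (1 + q)))"
proof -
  define w where "w m = (1 - q ^ m) * (1 + q ^ Suc m)" for m
  define \<delta> :: "nat \<Rightarrow> 'a" where "\<delta> m = (if m = 0 then 1 else 0)" for m
  define r d where "r = 1 / (1 - q)" and "d = 1 / (1 + q)"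
  have nz: "1 + q \<noteq> 0"
    using assms(2) by (metis add_eq_0_iff)
  \<comment> \<open>At \<open>t = -q\<close> the factor \<open>1 - t * q ^ m\<close> becomes
    \<open>1 + q ^ Suc m\<close>.\<close>
  have coeffs: "(\<lambda>m. qint q m * tqint (- q) q m) = (\<lambda>m. r\<^sup>2 * w m)"
    by (simp add: fun_eq_iff qint_def tqint_def r_def w_def power2_eq_square)
  \<comment> \<open>The initial sequence is supported at 0, so the factor \<open>r ^ m\<close>
    changes nothing; \<open>d\<close> normalises \<open>L 1 = 1 + q\<close> to 1.\<close>
  have \<delta>_scale: "\<delta> = (\<lambda>m. r ^ m * (d * mixed_moment q m 0))"
    using nz by (auto simp: \<delta>_def d_def mixed_moment_at_0)
  define b :: "nat \<Rightarrow> 'a" where "b k = of_nat (zbinom (2 * n) (int n - int k))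
      - of_nat (zbinom (2 * n) (int n - int k - 1))" for k
  have commute: "step w (\<lambda>m. d * mixed_moment q m j) k =
      step (\<lambda>_. 1) (\<lambda>i. d * mixed_moment q k i) j" for k j
    using arg_cong[OF step_mixed_moment[of q j k], of "\<lambda>x. d * x"]
    unfolding w_def by (cases j; cases k) (simp_all add: step_0 step_Suc algebra_simps)
  have "euler_tq n (- q) q = (step (\<lambda>m. r\<^sup>2 * w m) ^^ (2 * n)) \<delta> 0"
    unfolding euler_tq_def coeffs sfrac_nth_eq_step_funpow \<delta>_def ..
  also have "\<dots> = r ^ (2 * n) * (step w ^^ (2 * n)) (\<lambda>m. d * mixed_moment q m 0) 0"
    unfolding \<delta>_scale step_funpow_scale by simp
  also have "(step w ^^ (2 * n)) (\<lambda>m. d * mixed_moment q m 0) 0 =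
      (step (\<lambda>_. 1) ^^ (2 * n)) (\<lambda>i. d * mixed_moment q 0 i) 0"
    by (rule step_funpow_commute) (rule commute)
  also have "\<dots> = (\<Sum>k = 0..n. b k * (- 1) ^ k * ((q ^ (k\<^sup>2) + q ^ ((k + 1)\<^sup>2)) / (1 + q)))"
    unfolding step_funpow_ballot b_def mixed_moment_0 by (simp add: d_def mult.assoc)
  finally show ?thesis
    by (simp add: r_def b_def power_one_over)
qed

end
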